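(* Let $n\ge 1$, let $\Omega\subset\mathbb{R}^n$ be open, let $(X,d)$ be an arbitrary metric space, and let $f:\Omega\to X$ be Lipschitz. Let $\operatorname{Crit}(f)$ be the set of all $x\in\Omega$ at which $f$ is metrically differentiable and $\operatorname{rank}\,\mathrm{md}(f,x)<n$. Then $\mathcal{H}^n(f(\operatorname{Crit}(f)))=0$.
   Context: A seminorm on $\mathbb{R}^n$ is a function $\sigma:\mathbb{R}^n\to[0,\infty)$ with $\sigma(\lambda v)=|\lambda|\sigma(v)$ and $\sigma(v+w)\le\sigma(v)+\sigma(w)$. Its rank is $\operatorname{rank}\sigma=n-\dim\{v:\sigma(v)=0\}$. A map $f:\Omega\to X$ is metrically differentiable at $x\in\Omega$ if there is a seminorm $\sigma_x$ on $\mathbb{R}^n$ with $$\lim_{y\to x}\frac{d(f(y),f(x))-\sigma_x(y-x)}{|y-x|}=0;$$ such a $\sigma_x$ is unique and is denoted $\mathrm{md}(f,x)$. (By Kirchheim's theorem, a Lipschitz map is metrically differentiable at almost every point of $\Omega$.) $\mathcal{H}^n$ denotes the $n$-dimensional Hausdorff measure, normalized so that it equals Lebesgue measure on $\mathbb{R}^n$. *)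

theory Defs
  imports "HOL-Analysis.Analysis"
begin

definition seminorm :: "('a::real_vector \<Rightarrow> real) \<Rightarrow> bool" where
  "seminorm \<sigma> \<longleftrightarrow>
     (\<forall>v. 0 \<le> \<sigma> v) \<and>
     (\<forall>c v. \<sigma> (c *\<^sub>R v) = \<bar>c\<bar> * \<sigma> v) \<and>
     (\<forall>v w. \<sigma> (v + w) \<le> \<sigma> v + \<sigma> w)"

definition seminorm_rank :: "('a::euclidean_space \<Rightarrow> real) \<Rightarrow> nat" where
  "seminorm_rank \<sigma> = DIM('a) - dim {v. \<sigma> v = 0}"

text \<open>A map with domain \<open>\<Omega>\<close> is a total function whose values outside \<open>\<Omega>\<close> are irrelevant;
  accordingly the limit is taken within \<open>\<Omega>\<close>.\<close>

definition has_metric_derivative ::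
  "'a set \<Rightarrow> ('a::real_normed_vector \<Rightarrow> 'b::metric_space) \<Rightarrow> 'a \<Rightarrow> ('a \<Rightarrow> real) \<Rightarrow> bool" where
  "has_metric_derivative \<Omega> f x \<sigma> \<longleftrightarrow>
     seminorm \<sigma> \<and>
     ((\<lambda>y. (dist (f y) (f x) - \<sigma> (y - x)) / norm (y - x)) \<longlongrightarrow> 0) (at x within \<Omega>)"

definition metrically_differentiable ::
  "'a set \<Rightarrow> ('a::real_normed_vector \<Rightarrow> 'b::metric_space) \<Rightarrow> 'a \<Rightarrow> bool" where
  "metrically_differentiable \<Omega> f x \<longleftrightarrow> (\<exists>\<sigma>. has_metric_derivative \<Omega> f x \<sigma>)"

definition md ::
  "'a set \<Rightarrow> ('a::real_normed_vector \<Rightarrow> 'b::metric_space) \<Rightarrow> 'a \<Rightarrow> 'a \<Rightarrow> real" where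
  "md \<Omega> f x = (THE \<sigma>. has_metric_derivative \<Omega> f x \<sigma>)"

lemma has_metric_derivative_unique:
  fixes f :: "'a::real_normed_vector \<Rightarrow> 'b::metric_space"
  assumes "open \<Omega>" "x \<in> \<Omega>"
    and \<sigma>: "has_metric_derivative \<Omega> f x \<sigma>" and \<tau>: "has_metric_derivative \<Omega> f x \<tau>"
  shows "\<sigma> = \<tau>"
proof
  fix v :: 'a
  have hom: "\<sigma> (c *\<^sub>R w) = \<bar>c\<bar> * \<sigma> w" "\<tau> (c *\<^sub>R w) = \<bar>c\<bar> * \<tau> w" for c w
    using \<sigma> \<tau> by (auto simp: has_metric_derivative_def seminorm_def)
  show "\<sigma> v = \<tau> v"
  proof (cases "v = 0")
    case True
    then show ?thesis using hom[of 0 0] by simp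
  next
    case False
    let ?q = "\<lambda>y. (\<sigma> (y - x) - \<tau> (y - x)) / norm (y - x)"
    have "((\<lambda>y. (dist (f y) (f x) - \<tau> (y - x)) / norm (y - x)
              - (dist (f y) (f x) - \<sigma> (y - x)) / norm (y - x)) \<longlongrightarrow> 0 - 0) (at x)"
      using \<sigma> \<tau> unfolding has_metric_derivative_def at_within_open[OF assms(2,1)]
      by (intro tendsto_diff) auto
    then have lim: "(?q \<longlongrightarrow> 0) (at x)"
      by (simp add: diff_divide_distrib)
    have "((\<lambda>t. x + t *\<^sub>R v) \<longlongrightarrow> x + 0 *\<^sub>R v) (at_right 0)"
      by (intro tendsto_intros)
    moreover have "eventually (\<lambda>t. x + t *\<^sub>R v \<noteq> x) (at_right (0::real))"
      using False by (auto simp: eventually_at_filter)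
    ultimately have "filterlim (\<lambda>t. x + t *\<^sub>R v) (at x) (at_right 0)"
      by (simp add: filterlim_at)
    from filterlim_compose[OF lim this]
    have "((\<lambda>t. ?q (x + t *\<^sub>R v)) \<longlongrightarrow> 0) (at_right 0)" .
    moreover have "eventually (\<lambda>t. ?q (x + t *\<^sub>R v) = (\<sigma> v - \<tau> v) / norm v) (at_right 0)"
    proof (rule eventually_mono[OF eventually_at_right_less])
      fix t :: real assume t: "0 < t"
      have "?q (x + t *\<^sub>R v) = (t * (\<sigma> v - \<tau> v)) / (t * norm v)"
        using t by (simp add: hom right_diff_distrib)
      also have "\<dots> = (\<sigma> v - \<tau> v) / norm v"
        using t by simp
      finally show "?q (x + t *\<^sub>R v) = (\<sigma> v - \<tau> v) / norm v" .
    qed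
    ultimately have "((\<lambda>t. (\<sigma> v - \<tau> v) / norm v) \<longlongrightarrow> 0) (at_right (0::real))"
      using filterlim_cong by fastforce
    then have "(\<sigma> v - \<tau> v) / norm v = 0"
      by (simp add: tendsto_const_iff)
    with False show ?thesis by simp
  qed
qed

lemma md_eqI:
  assumes "open \<Omega>" "x \<in> \<Omega>" "has_metric_derivative \<Omega> f x \<sigma>"
  shows "md \<Omega> f x = \<sigma>"
  unfolding md_def using assms has_metric_derivative_unique by blast

definition Crit :: "'a set \<Rightarrow> ('a::euclidean_space \<Rightarrow> 'b::metric_space) \<Rightarrow> 'a set" where
  "Crit \<Omega> f =
     {x \<in> \<Omega>. metrically_differentiable \<Omega> f x \<and> seminorm_rank (md \<Omega> f x) < DIM('a)}"

text \<open>Hausdorff (outer) measure, defined on all subsets. The factor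
  \<open>unit_ball_vol n / 2 ^ n\<close> is the volume of a Euclidean ball of diameter 1, which by the
  isodiametric inequality makes the measure agree with Lebesgue measure on \<open>n\<close>-dimensional
  Euclidean space. Boundedness of the covering sets is explicit because \<^const>\<open>diameter\<close> is
  a real number that is meaningless for unbounded sets. The empty set is given weight 0 also
  for \<open>n = 0\<close>, where \<open>0 ^ 0 = 1\<close>. If \<open>A\<close> has no admissible countable cover, the infimum
  is \<open>\<infinity>\<close>.\<close>

definition hausdorff_pre_measure :: "nat \<Rightarrow> real \<Rightarrow> 'a::metric_space set \<Rightarrow> ennreal" where
  "hausdorff_pre_measure n \<delta> A =
     (INF E \<in> {E :: nat \<Rightarrow> 'a set. A \<subseteq> (\<Union>i. E i) \<and> (\<forall>i. bounded (E i) \<and> diameter (E i) \<le> \<delta>)}.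
        \<Sum>i. ennreal (if E i = {} then 0
                    else unit_ball_vol (real n) / 2 ^ n * diameter (E i) ^ n))"

definition hausdorff_measure :: "nat \<Rightarrow> 'a::metric_space set \<Rightarrow> ennreal" where
  "hausdorff_measure n A = (SUP \<delta> \<in> {0<..}. hausdorff_pre_measure n \<delta> A)"

end

theory Submission
  imports Defs
begin

text \<open>
  At a critical point \<open>x\<close> the metric derivative vanishes on some \<open>v \<noteq> 0\<close>, so
  \<open>f (x + t v)\<close> stays within \<open>o(t)\<close> of \<open>f x\<close>. Together with the Lipschitz bound this makes
  the image of the critical set small. Let \<open>B\<close> be a set of points at which \<open>f\<close> moves by at most \<open>\<bar>t\<bar> / m\<close> along
  one common direction \<open>v\<close>, for all \<open>t\<close> up to a common scale \<open>\<rho>\<close>, and take a cube of side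
  \<open>s\<close> well below \<open>\<rho>\<close>. Cut the cube into about \<open>m ^ (n - 1)\<close> tubes parallel to \<open>v\<close> of width
  \<open>s / m\<close>. If \<open>x\<close> and \<open>y\<close> are points of \<open>B\<close> in the same tube, then sliding from \<open>y\<close> along \<open>v\<close>
  changes the value of \<open>f\<close> by at most \<open>s / m\<close>, because \<open>y\<close> itself belongs to \<open>B\<close>, and ends
  at a point whose distance to \<open>x\<close> is of order \<open>s / m\<close>; the Lipschitz bound does the rest. So
  each tube contributes a set of diameter of order \<open>s / m\<close>, and the part of \<open>B\<close> in the cube
  costs at most a constant times \<open>m ^ (n - 1) * (s / m) ^ n = s ^ n / m\<close>: the volume of the cube
  times \<open>1 / m\<close> (\<open>hausdorff_pre_measure_image_cube_le\<close>). The behaviour of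
  \<open>f\<close> along \<open>v\<close> enters only through segments that start at a point of \<open>B\<close>, which is exactly what
  differentiability at that point controls.

  If \<open>B\<close> is bounded and Borel, covering it by small cubes inside an open set of nearly the same measure turns
  this into a bound by a constant times the volume of \<open>B\<close> over \<open>m\<close>
  (\<open>hausdorff_pre_measure_image_nearly_constant_le\<close>). For fixed \<open>m\<close> the critical set is covered
  by countably many such sets, with directions from a countable dense set and scales
  \<open>1 / (k + 1)\<close> (\<open>Crit_subset_nearly_constant_along\<close>). The
  covering sets are closed, so inside a bounded region they can be replaced by disjoint Borel pieces
  whose volumes add up to at most the volume of the region. The total cost is therefore a constant
  over \<open>m\<close>, with the constant independent of \<open>m\<close> (\<open>hausdorff_pre_measure_image_Crit_le\<close>), and
  \<open>m\<close> is arbitrary.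
\<close>

section \<open>Hausdorff pre-measure\<close>

lemma hausdorff_pre_measure_mono:
  assumes "A \<subseteq> B"
  shows "hausdorff_pre_measure n \<delta> A \<le> hausdorff_pre_measure n \<delta> B"
  unfolding hausdorff_pre_measure_def using assms by (intro INF_superset_mono) auto

text \<open>The usual argument for outer measures: covers of the \<open>A i\<close> that are optimal up to
  \<open>e / 2 ^ (i + 1)\<close> are merged by a pairing of the indices.\<close>

lemma hausdorff_pre_measure_UN_le:
  fixes A :: "nat \<Rightarrow> 'x::metric_space set"
  shows "hausdorff_pre_measure n \<delta> (\<Union>i. A i) \<le> (\<Sum>i. hausdorff_pre_measure n \<delta> (A i))"
proof (rule ennreal_le_epsilon)
  let ?h = "hausdorff_pre_measure n \<delta>"
  define w :: "'x set \<Rightarrow> ennreal" where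
    "w = (\<lambda>E. ennreal (if E = {} then 0 else unit_ball_vol (real n) / 2 ^ n * diameter E ^ n))"
  define adm where "adm = (\<lambda>E :: 'x set. bounded E \<and> diameter E \<le> \<delta>)"
  have h: "?h S = (INF E \<in> {E. S \<subseteq> (\<Union>i. E i) \<and> (\<forall>i. adm (E i))}. \<Sum>i. w (E i))" for S
    by (simp add: hausdorff_pre_measure_def w_def adm_def)
  fix e :: real assume e: "0 < e" and fin: "(\<Sum>i. ?h (A i)) < top"
  have "\<exists>E. A i \<subseteq> (\<Union>j. E j) \<and> (\<forall>j. adm (E j)) \<and> (\<Sum>j. w (E j)) \<le> ?h (A i) + e * (1/2) ^ Suc i" for i
  proof -
    have "?h (A i) < ?h (A i) + e * (1/2) ^ Suc i"
      using fin e by (auto simp: less_top dest!: ennreal_suminf_lessD)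
    then show ?thesis
      unfolding h[of "A i"] by (subst (asm) INF_less_iff) (auto intro: less_imp_le)
  qed
  then obtain E where E: "\<And>i. A i \<subseteq> (\<Union>j. E i j)" "\<And>i j. adm (E i j)"
      "\<And>i. (\<Sum>j. w (E i j)) \<le> ?h (A i) + e * (1/2) ^ Suc i"
    by metis
  define C where "C = case_prod E \<circ> prod_decode"
  have "(\<Union>i. A i) \<subseteq> (\<Union>i. C i)"
    using E(1) by (auto simp: C_def subset_eq) (metis prod.case prod_encode_inverse)
  moreover have "adm (C i)" for i
    using E(2) by (simp add: C_def split: prod.split)
  ultimately have "?h (\<Union>i. A i) \<le> (\<Sum>i. w (C i))"
    unfolding h by (intro INF_lower) auto
  also have "\<dots> = (\<Sum>i. (\<lambda>p. w (case_prod E p)) (prod_decode i))"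
    by (simp add: C_def)
  also have "\<dots> = (\<Sum>i. \<Sum>j. w (E i j))"
    by (intro suminf_ennreal_2dimen) auto
  also have "\<dots> \<le> (\<Sum>i. ?h (A i) + e * (1/2) ^ Suc i)"
    by (intro suminf_le allI E) auto
  also have "\<dots> = (\<Sum>i. ?h (A i)) + (\<Sum>i. ennreal e * ennreal ((1/2) ^ Suc i))"
    using e by (subst suminf_add[symmetric])
      (auto simp del: ennreal_suminf_cmult simp add: ennreal_mult[symmetric])
  also have "\<dots> = (\<Sum>i. ?h (A i)) + e"
    unfolding ennreal_suminf_cmult
    by (subst suminf_ennreal_eq[OF zero_le_power power_half_series]) auto
  finally show "?h (\<Union>i. A i) \<le> (\<Sum>i. ?h (A i)) + e" .
qed

text \<open>The covering sets are the images of the fibres of \<open>g\<close>; the map \<open>g\<close> only labels the pieces into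
  which \<open>S\<close> is cut.\<close>

lemma hausdorff_pre_measure_image_le_card:
  fixes f :: "'a \<Rightarrow> 'x::metric_space" and g :: "'a \<Rightarrow> 'c"
  assumes I: "finite I" "g ` S \<subseteq> I" and D: "0 \<le> D" "D \<le> \<delta>"
    and fibre: "\<And>x y. x \<in> S \<Longrightarrow> y \<in> S \<Longrightarrow> g x = g y \<Longrightarrow> dist (f x) (f y) \<le> D"
  shows "hausdorff_pre_measure n \<delta> (f ` S)
    \<le> ennreal (real (card I) * (unit_ball_vol (real n) / 2 ^ n * D ^ n))"
proof -
  obtain h where h: "bij_betw h {..<card I} I"
    using I(1) bij_betw_from_nat_into_finite by blast
  define E where "E k = (if k < card I then f ` {x \<in> S. g x = h k} else {})" for k
  have dE: "dist a b \<le> D" if "a \<in> E k" "b \<in> E k" for a b k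
    using that fibre by (auto simp: E_def split: if_splits)
  have diam: "diameter (E k) \<le> D" for k
  proof (cases "E k = {}")
    case True then show ?thesis using D by simp
  next
    case False then show ?thesis
      unfolding diameter_def using dE by (auto intro!: cSUP_least)
  qed
  have bdd: "bounded (E k)" for k
    unfolding bounded_def using dE by metis
  have cov: "f ` S \<subseteq> (\<Union>k. E k)"
  proof clarify
    fix x assume "x \<in> S"
    with I(2) h obtain k where "k < card I" "g x = h k"
      by (metis bij_betw_imp_surj_on image_iff image_subset_iff lessThan_iff)
    with \<open>x \<in> S\<close> show "f x \<in> (\<Union>k. E k)"
      by (auto simp: E_def intro!: exI[of _ k])
  qed
  let ?c = "unit_ball_vol (real n) / 2 ^ n"
  have "hausdorff_pre_measure n \<delta> (f ` S) \<le>
      (\<Sum>k. ennreal (if E k = {} then 0 else ?c * diameter (E k) ^ n))"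
    unfolding hausdorff_pre_measure_def
    using cov bdd order_trans[OF diam D(2)] by (intro INF_lower) auto
  also have "\<dots> = (\<Sum>k<card I. ennreal (if E k = {} then 0 else ?c * diameter (E k) ^ n))"
    by (intro suminf_finite) (auto simp: E_def)
  also have "\<dots> \<le> (\<Sum>k<card I. ennreal (?c * D ^ n))"
    using diam D bdd
    by (intro sum_mono ennreal_leI)
       (auto intro!: mult_left_mono divide_right_mono power_mono diameter_ge_0)
  also have "\<dots> = ennreal (real (card I) * (?c * D ^ n))"
    using D by (simp add: ennreal_of_nat_eq_real_of_nat flip: ennreal_mult)
  finally show ?thesis .
qed

section \<open>Points where a map is nearly constant in a fixed direction\<close>

text \<open>The condition on the ball keeps the segments inside \<open>\<Omega>\<close>, where \<open>f\<close> is controlled. The ball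
  is open and the inequality on \<open>t\<close> strict so that the set is closed.\<close>

definition nearly_constant_along ::
  "'a set \<Rightarrow> ('a::real_normed_vector \<Rightarrow> 'x::metric_space) \<Rightarrow> 'a \<Rightarrow> real \<Rightarrow> real \<Rightarrow> 'a set" where
  "nearly_constant_along \<Omega> f v \<rho> \<epsilon> =
     {x. ball x \<rho> \<subseteq> \<Omega> \<and> (\<forall>t. norm (t *\<^sub>R v) < \<rho> \<longrightarrow> dist (f (x + t *\<^sub>R v)) (f x) \<le> \<epsilon> * \<bar>t\<bar>)}"

text \<open>For fixed \<open>t\<close> the inequality compares continuous functions of \<open>x\<close>, and the points whose
  distance to the complement of \<open>\<Omega>\<close> is at least \<open>\<rho>\<close> form a closed set.\<close>

lemma closed_nearly_constant_along:
  fixes f :: "'a::real_normed_vector \<Rightarrow> 'x::metric_space"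
  assumes f: "continuous_on \<Omega> f" and "0 < \<rho>"
  shows "closed (nearly_constant_along \<Omega> f v \<rho> \<epsilon>)"
proof -
  define S where "S = {x. ball x \<rho> \<subseteq> \<Omega>}"
  have "S = - (\<Union>y \<in> - \<Omega>. ball y \<rho>)"
    by (auto simp: S_def subset_eq dist_commute)
  then have "closed S" by auto
  have clt: "closed {x \<in> S. dist (f (x + t *\<^sub>R v)) (f x) \<le> \<epsilon> * \<bar>t\<bar>}" if "norm (t *\<^sub>R v) < \<rho>" for t
  proof (rule continuous_on_closed_Collect_le[OF _ continuous_on_const \<open>closed S\<close>])
    have "x + t *\<^sub>R v \<in> \<Omega>" "x \<in> \<Omega>" if "x \<in> S" for x
      using that \<open>norm (t *\<^sub>R v) < \<rho>\<close> \<open>0 < \<rho>\<close> by (auto simp: S_def subset_eq dist_norm)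
    then show "continuous_on S (\<lambda>x. dist (f (x + t *\<^sub>R v)) (f x))"
      by (intro continuous_on_dist continuous_on_compose2[OF f] continuous_intros) auto
  qed
  have "nearly_constant_along \<Omega> f v \<rho> \<epsilon> =
      S \<inter> (\<Inter>t \<in> {t. norm (t *\<^sub>R v) < \<rho>}. {x \<in> S. dist (f (x + t *\<^sub>R v)) (f x) \<le> \<epsilon> * \<bar>t\<bar>})"
    by (auto simp: nearly_constant_along_def S_def)
  then show ?thesis
    using \<open>closed S\<close> clt by (auto intro!: closed_Int closed_INT)
qed

text \<open>Directions are normalized in the maximum norm. Projecting along \<open>v\<close> onto the
  hyperplane orthogonal to the coordinate \<open>i\<close> with \<open>v \<bullet> i = 1\<close> is then just
  \<open>x - (x \<bullet> i) v\<close>, and it enlarges coordinates by a bounded factor.\<close>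

definition max_coordinate_one :: "'a::euclidean_space set" where
  "max_coordinate_one = {v. (\<exists>i\<in>Basis. v \<bullet> i = 1) \<and> (\<forall>j\<in>Basis. \<bar>v \<bullet> j\<bar> \<le> 1)}"

lemma norm_max_coordinate_one_le:
  fixes v :: "'a::euclidean_space"
  assumes "v \<in> max_coordinate_one"
  shows "norm v \<le> DIM('a)"
proof -
  have "norm v \<le> (\<Sum>b\<in>Basis. \<bar>v \<bullet> b\<bar>)" by (rule norm_le_l1)
  also have "\<dots> \<le> (\<Sum>b\<in>(Basis::'a set). 1)"
    using assms by (intro sum_mono) (auto simp: max_coordinate_one_def)
  finally show ?thesis by simp
qed

text \<open>The tubes are the preimages, under the projection \<open>P\<close> along \<open>v\<close> onto the
  hyperplane \<open>x \<bullet> i = 0\<close>, of a grid of mesh \<open>s / m\<close>. There are only \<open>n - 1\<close> free coordinates, so one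
  factor \<open>m\<close> is gained over the number of grid cells in the full cube.\<close>

lemma hausdorff_pre_measure_image_cube_le:
  fixes f :: "'a::euclidean_space \<Rightarrow> 'x::metric_space"
  assumes lip: "L-lipschitz_on \<Omega> f" and v: "v \<in> max_coordinate_one"
    and B: "B \<subseteq> nearly_constant_along \<Omega> f v \<rho> (1 / real m)" and m: "0 < m"
    and cube: "\<And>i. i \<in> Basis \<Longrightarrow> w \<bullet> i - u \<bullet> i = s" and s: "0 < s" "s * DIM('a) < \<rho>"
    and \<delta>: "(1 + L * DIM('a)) * s / m \<le> \<delta>"
  shows "hausdorff_pre_measure DIM('a) \<delta> (f ` (B \<inter> cbox u w))
    \<le> ennreal (unit_ball_vol DIM('a) / 2 ^ DIM('a) * (4 * (1 + L * DIM('a))) ^ DIM('a) / m * s ^ DIM('a))"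
proof -
  let ?n = "DIM('a)"
  define D where "D = (1 + L * ?n) * s / m"
  have L: "0 \<le> L" using lip by (rule lipschitz_on_nonneg)
  have D: "0 \<le> D" "D \<le> \<delta>" using L s m \<delta> by (auto simp: D_def)
  obtain i where i: "i \<in> Basis" "v \<bullet> i = 1" and vj: "\<And>j. j \<in> Basis \<Longrightarrow> \<bar>v \<bullet> j\<bar> \<le> 1"
    using v by (auto simp: max_coordinate_one_def)
  define P where "P x = (x - u) - ((x - u) \<bullet> i) *\<^sub>R v" for x
  \<comment> \<open>Coordinates of \<open>P x\<close> lie between \<open>- s\<close> and \<open>2 * s\<close>; in units of the mesh \<open>s / m\<close> and shifted by
    \<open>s\<close> they lie between \<open>0\<close> and \<open>3 * m\<close>.\<close>
  define q where "q x j = (P x \<bullet> j + s) * m / s" for x j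
  define g where "g x = (\<lambda>j \<in> Basis - {i}. nat \<lfloor>q x j\<rfloor>)" for x
  define I where "I = (\<Pi>\<^sub>E j\<in>Basis - {i}. {0..3 * m})"
  have coord: "0 \<le> (x - u) \<bullet> j" "(x - u) \<bullet> j \<le> s" if "x \<in> cbox u w" "j \<in> Basis" for x j
    using that cube[of j] by (fastforce simp: mem_box inner_diff_left)+
  have Pj: "- s \<le> P x \<bullet> j" "P x \<bullet> j \<le> 2 * s" if "x \<in> cbox u w" "j \<in> Basis" for x j
  proof -
    have "\<bar>((x - u) \<bullet> i) * (v \<bullet> j)\<bar> \<le> s * 1"
      unfolding abs_mult using coord[OF that(1) i(1)] vj[OF that(2)] s by (intro mult_mono) auto
    then show "- s \<le> P x \<bullet> j" "P x \<bullet> j \<le> 2 * s"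
      using coord[OF that] by (auto simp: P_def inner_diff_left)
  qed
  have q: "0 \<le> q x j" "q x j \<le> 3 * m" if "x \<in> cbox u w" "j \<in> Basis" for x j
  proof -
    have "0 \<le> P x \<bullet> j + s" "P x \<bullet> j + s \<le> 3 * s" using Pj[OF that] by linarith+
    then have "0 \<le> (P x \<bullet> j + s) * m" "(P x \<bullet> j + s) * m \<le> (3 * s) * m"
      by (auto intro: mult_right_mono)
    then show "0 \<le> q x j" "q x j \<le> 3 * m" using s by (auto simp: q_def field_simps)
  qed
  have "finite I" by (auto simp: I_def intro: finite_PiE)
  have cardI: "card I = (3 * m + 1) ^ (?n - 1)"
    using i by (simp add: I_def card_PiE card_Diff_singleton)
  have gI: "g ` (B \<inter> cbox u w) \<subseteq> I"
  proof -
    have "nat \<lfloor>q x j\<rfloor> \<le> 3 * m" if "x \<in> cbox u w" "j \<in> Basis" for x j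
      using q[OF that] by linarith
    then show ?thesis
      unfolding image_subset_iff g_def I_def by (intro ballI restrict_PiE_iff[THEN iffD2]) auto
  qed
  have fibre: "dist (f x) (f y) \<le> D"
    if x: "x \<in> B \<inter> cbox u w" and y: "y \<in> B \<inter> cbox u w" and eq: "g x = g y" for x y
  proof -
    \<comment> \<open>The amount to slide from \<open>y\<close> along \<open>v\<close> to reach the height of \<open>x\<close>.\<close>
    define t where "t = (x - y) \<bullet> i"
    have diffj: "\<bar>(P x - P y) \<bullet> j\<bar> \<le> s / m" if "j \<in> Basis" for j
    proof (cases "j = i")
      case True
      then have "P x \<bullet> j = 0" "P y \<bullet> j = 0" using i by (simp_all add: P_def inner_diff_left)
      then show ?thesis using s by (simp add: inner_diff_left)
    next
      case False
      with that have "nat \<lfloor>q x j\<rfloor> = nat \<lfloor>q y j\<rfloor>"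
        using fun_cong[OF eq, of j] by (simp add: g_def)
      then have "\<bar>q x j - q y j\<bar> \<le> 1"
        using q(1)[of x j] q(1)[of y j] x y that by (simp add: nat_eq_iff) linarith
      moreover have "q x j - q y j = ((P x - P y) \<bullet> j) * (m / s)"
        using s by (simp add: q_def inner_diff_left field_simps)
      ultimately have "\<bar>(P x - P y) \<bullet> j\<bar> * (m / s) \<le> 1"
        using s m by (simp add: abs_mult)
      then show ?thesis using s m by (simp add: field_simps)
    qed
    have "norm (P x - P y) \<le> (\<Sum>j\<in>Basis. \<bar>(P x - P y) \<bullet> j\<bar>)" by (rule norm_le_l1)
    also have "\<dots> \<le> (\<Sum>j\<in>(Basis::'a set). s / m)" by (intro sum_mono diffj)
    finally have nP: "norm (P x - P y) \<le> ?n * (s / m)" by simp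
    have xy: "x - (y + t *\<^sub>R v) = P x - P y"
      by (simp add: P_def t_def algebra_simps inner_diff_left)
    have t: "\<bar>t\<bar> \<le> s"
      using coord[of x i] coord[of y i] x y i by (auto simp: t_def inner_diff_left)
    have "norm (t *\<^sub>R v) \<le> s * ?n"
      using t norm_max_coordinate_one_le[OF v] s by (auto intro!: mult_mono)
    with s have tv: "norm (t *\<^sub>R v) < \<rho>" by linarith
    have y': "y \<in> nearly_constant_along \<Omega> f v \<rho> (1 / m)" "x \<in> nearly_constant_along \<Omega> f v \<rho> (1 / m)"
      using x y B by auto
    have "0 < \<rho>" using tv by (metis norm_ge_zero order_le_less_trans)
    then have \<Omega>: "y + t *\<^sub>R v \<in> \<Omega>" "x \<in> \<Omega>"
      using y' tv by (auto simp: nearly_constant_along_def subset_eq dist_norm)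
    have "dist (f x) (f y) \<le> dist (f x) (f (y + t *\<^sub>R v)) + dist (f (y + t *\<^sub>R v)) (f y)"
      by (rule dist_triangle)
    also have "\<dots> \<le> L * (?n * (s / m)) + 1 / m * s"
    proof (rule add_mono)
      have "dist (f x) (f (y + t *\<^sub>R v)) \<le> L * dist x (y + t *\<^sub>R v)"
        using lip \<Omega> by (auto dest: lipschitz_onD)
      also have "\<dots> \<le> L * (?n * (s / m))"
        unfolding dist_norm xy using nP L by (intro mult_left_mono)
      finally show "dist (f x) (f (y + t *\<^sub>R v)) \<le> L * (?n * (s / m))" .
      have "dist (f (y + t *\<^sub>R v)) (f y) \<le> 1 / m * \<bar>t\<bar>"
        using y'(1) tv by (auto simp: nearly_constant_along_def)
      also have "\<dots> \<le> 1 / m * s" using t by (intro mult_left_mono) auto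
      finally show "dist (f (y + t *\<^sub>R v)) (f y) \<le> 1 / m * s" .
    qed
    also have "\<dots> = D" by (simp add: D_def field_simps add_divide_distrib)
    finally show ?thesis .
  qed
  define c where "c = unit_ball_vol (real ?n) / 2 ^ ?n"
  have c: "0 \<le> c" by (simp add: c_def)
  have "hausdorff_pre_measure ?n \<delta> (f ` (B \<inter> cbox u w)) \<le> ennreal (real (card I) * (c * D ^ ?n))"
    unfolding c_def
    by (rule hausdorff_pre_measure_image_le_card[OF \<open>finite I\<close> gI D fibre])
  also have "\<dots> \<le> ennreal (c * (4 * (1 + L * ?n)) ^ ?n / m * s ^ ?n)"
  proof (rule ennreal_leI)
    obtain k where k: "?n = Suc k" using DIM_positive[where 'a='a] gr0_implies_Suc by blast
    have "real (card I) = (3 * real m + 1) ^ k" by (simp add: cardI k add.commute)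
    also have "\<dots> \<le> (4 * real m) ^ k" using m by (intro power_mono) auto
    also have "\<dots> \<le> 4 ^ ?n * real m ^ k" by (simp add: k power_mult_distrib)
    finally have "real (card I) \<le> 4 ^ ?n * real m ^ k" .
    then have "real (card I) * (c * D ^ ?n) \<le> (4 ^ ?n * real m ^ k) * (c * D ^ ?n)"
      using c D by (intro mult_right_mono) auto
    also have "\<dots> = c * (4 * (1 + L * ?n)) ^ ?n / m * s ^ ?n"
    proof -
      have "D ^ ?n = (1 + L * ?n) ^ ?n * s ^ ?n / (real m * real m ^ k)"
        by (simp add: D_def power_divide power_mult_distrib k)
      then show ?thesis using m unfolding power_mult_distrib[of 4] by simp
    qed
    finally show "real (card I) * (c * D ^ ?n) \<le> c * (4 * (1 + L * ?n)) ^ ?n / m * s ^ ?n" .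
  qed
  finally show ?thesis by (simp add: c_def)
qed

text \<open>The cubes come from a dyadic subdivision (\<open>covering_lemma\<close>) fine enough for the cube
  estimate and for the bound \<open>\<delta>\<close> on diameters, and contained in an open set slightly larger than
  \<open>B\<close>. Their interiors are disjoint and carry all of their volume.\<close>

lemma hausdorff_pre_measure_image_nearly_constant_le:
  fixes f :: "'a::euclidean_space \<Rightarrow> 'x::metric_space"
  assumes lip: "L-lipschitz_on \<Omega> f" and v: "v \<in> max_coordinate_one" and m: "0 < m"
    and B: "B \<in> sets borel" "bounded B" "B \<subseteq> nearly_constant_along \<Omega> f v \<rho> (1 / real m)"
    and pos: "0 < \<rho>" "0 < \<delta>" "0 < \<eta>"
  shows "hausdorff_pre_measure DIM('a) \<delta> (f ` B)
    \<le> ennreal (unit_ball_vol DIM('a) / 2 ^ DIM('a) * (4 * (1 + L * DIM('a))) ^ DIM('a) / m)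
        * (emeasure lborel B + ennreal \<eta>)"
proof -
  let ?n = "DIM('a)" and ?h = "hausdorff_pre_measure DIM('a) \<delta>"
  define C where "C = unit_ball_vol ?n / 2 ^ ?n * (4 * (1 + L * ?n)) ^ ?n / m"
  have L: "0 \<le> L" using lip by (rule lipschitz_on_nonneg)
  have C: "0 \<le> C" using L by (simp add: C_def)
  obtain U where U: "open U" "B \<subseteq> U" "emeasure lborel (U - B) < ennreal \<eta>"
    using outer_regular_lborel[OF B(1) pos(3)] by blast
  \<comment> \<open>A cube contained in a ball of radius \<open>r\<close> has side below \<open>2 * r\<close>; the two bounds are what the
    cube estimate asks of the side.\<close>
  define r where "r = min (\<rho> / (3 * ?n)) (\<delta> / (2 * (1 + L * ?n)))"
  have L1: "0 < 1 + L * ?n" using L by (simp add: add_pos_nonneg)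
  have r: "0 < r" "2 * r * ?n < \<rho>" "(1 + L * ?n) * (2 * r) \<le> \<delta>"
  proof -
    show "0 < r" using pos L1 by (simp add: r_def)
    have "r \<le> \<rho> / (3 * ?n)" by (simp add: r_def)
    then have "3 * r * ?n \<le> \<rho>" by (simp add: field_simps)
    moreover have "0 < r * ?n" using \<open>0 < r\<close> by simp
    ultimately show "2 * r * ?n < \<rho>" by linarith
    have "r \<le> \<delta> / (2 * (1 + L * ?n))" by (simp add: r_def)
    then show "(1 + L * ?n) * (2 * r) \<le> \<delta>" using L1 by (simp add: field_simps)
  qed
  obtain M where M: "0 < M" "\<And>x. x \<in> B \<Longrightarrow> norm x \<le> M"
    using B(2) by (auto simp: bounded_pos)
  define b :: 'a where "b = M *\<^sub>R One"
  have BQ: "B \<subseteq> cbox (- b) b"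
  proof
    fix x assume "x \<in> B"
    have "\<bar>x \<bullet> i\<bar> \<le> M" if "i \<in> Basis" for i
      using Basis_le_norm[OF that, of x] M(2)[OF \<open>x \<in> B\<close>] by linarith
    then show "x \<in> cbox (- b) b" by (auto simp: mem_box b_def abs_le_iff minus_le_iff)
  qed
  have Q: "box (- b) b \<noteq> {}" using M by (simp add: box_ne_empty b_def)
  define gg where "gg x = (if x \<in> U then U \<inter> ball x r else ball x r)" for x
  have "gauge gg" using U(1) r(1) by (auto simp: gauge_def gg_def)
  obtain \<D> where \<D>: "countable \<D>" "\<And>K. K \<in> \<D> \<Longrightarrow> interior K \<noteq> {} \<and> (\<exists>c d. K = cbox c d)"
      "pairwise (\<lambda>A B. interior A \<inter> interior B = {}) \<D>"
      "\<And>K. K \<in> \<D> \<Longrightarrow> \<exists>x \<in> B \<inter> K. K \<subseteq> gg x"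
      "\<And>u w. cbox u w \<in> \<D> \<Longrightarrow> \<exists>n. \<forall>i \<in> Basis. w \<bullet> i - u \<bullet> i = (b \<bullet> i - (- b) \<bullet> i) / 2^n"
      "B \<subseteq> \<Union>\<D>"
    using covering_lemma[OF BQ Q \<open>gauge gg\<close>] by metis
  have cube: "?h (f ` (B \<inter> K)) \<le> ennreal C * emeasure lborel (interior K)" if K: "K \<in> \<D>" for K
  proof -
    obtain u w where uw: "K = cbox u w" using \<D>(2)[OF K] by blast
    with \<D>(5) K obtain k where k: "\<And>i. i \<in> Basis \<Longrightarrow> w \<bullet> i - u \<bullet> i = (b \<bullet> i - (- b) \<bullet> i) / 2^k"
      by blast
    define s where "s = 2 * M / 2 ^ k"
    have side: "w \<bullet> i - u \<bullet> i = s" if "i \<in> Basis" for i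
      using k[OF that] that by (simp add: s_def b_def)
    have s: "0 < s" using M by (simp add: s_def)
    have le: "u \<bullet> i \<le> w \<bullet> i" if "i \<in> Basis" for i
      using side[OF that] s by linarith
    obtain x where x: "K \<subseteq> ball x r" using \<D>(4)[OF K] by (auto simp: gg_def split: if_splits)
    have "s < 2 * r"
    proof -
      obtain i :: 'a where i: "i \<in> Basis" using nonempty_Basis by blast
      have "u \<in> ball x r" "w \<in> ball x r" using x uw le by (auto simp: mem_box subset_eq)
      then have "dist w u < 2 * r" using dist_triangle_half_r[of x w "2 * r" u] by auto
      moreover have "\<bar>(w - u) \<bullet> i\<bar> \<le> norm (w - u)" by (rule Basis_le_norm[OF i])
      ultimately show ?thesis using side[OF i] by (simp add: dist_norm inner_diff_left)
    qed
    have s\<rho>: "s * ?n < \<rho>"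
    proof -
      have "s * ?n \<le> 2 * r * ?n" using \<open>s < 2 * r\<close> by (intro mult_right_mono) auto
      with r(2) show ?thesis by linarith
    qed
    have s\<delta>: "(1 + L * ?n) * s / m \<le> \<delta>"
    proof -
      have "(1 + L * ?n) * s / m \<le> (1 + L * ?n) * s / 1"
        using L1 s m by (intro divide_left_mono) auto
      also have "\<dots> \<le> (1 + L * ?n) * (2 * r)" using L1 \<open>s < 2 * r\<close> by simp
      finally show ?thesis using r(3) by linarith
    qed
    have "emeasure lborel (interior K) = ennreal (\<Prod>i\<in>(Basis::'a set). s)"
      using le side by (simp add: uw interior_cbox emeasure_lborel_box inner_diff_left cong: prod.cong)
    then have vol: "emeasure lborel (interior K) = ennreal (s ^ ?n)" by simp
    have "?h (f ` (B \<inter> K)) \<le> ennreal (C * s ^ ?n)"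
      unfolding uw C_def
      by (rule hausdorff_pre_measure_image_cube_le[OF lip v B(3) m side s s\<rho> s\<delta>])
    then show ?thesis using C by (simp add: vol ennreal_mult')
  qed
  \<comment> \<open>An enumeration of the cubes without repetitions, padded by empty sets if there are finitely
    many.\<close>
  define K where "K k = (if k \<in> to_nat_on \<D> ` \<D> then from_nat_into \<D> k else {})" for k
  have K: "K k = {} \<or> K k \<in> \<D> \<and> to_nat_on \<D> (K k) = k" for k
    using \<D>(1) by (auto simp: K_def)
  have KU: "(\<Union>k. K k) = \<Union>\<D>"
  proof
    show "(\<Union>k. K k) \<subseteq> \<Union>\<D>" using K by blast
    show "\<Union>\<D> \<subseteq> (\<Union>k. K k)"
    proof clarify
      fix x E assume "x \<in> E" "E \<in> \<D>"
      then show "x \<in> (\<Union>k. K k)"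
        using \<D>(1) by (auto simp: K_def intro!: exI[of _ "to_nat_on \<D> E"])
    qed
  qed
  have disj: "disjoint_family (\<lambda>k. interior (K k))"
    unfolding disjoint_family_on_def
  proof (intro ballI impI)
    fix k l :: nat assume "k \<noteq> l"
    show "interior (K k) \<inter> interior (K l) = {}"
    proof (cases "K k = {} \<or> K l = {}")
      case True then show ?thesis by auto
    next
      case False
      then have "K k \<in> \<D>" "K l \<in> \<D>" "K k \<noteq> K l" using K \<open>k \<noteq> l\<close> by metis+
      then show ?thesis using \<D>(3) by (auto simp: pairwise_def)
    qed
  qed
  have intU: "(\<Union>k. interior (K k)) \<subseteq> U"
  proof -
    have "interior (K k) \<subseteq> U" for k
    proof (cases "K k = {}")
      case False
      then obtain x where "x \<in> B" "K k \<subseteq> gg x" using K \<D>(4) by blast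
      then show ?thesis using U(2) interior_subset by (fastforce simp: gg_def)
    qed auto
    then show ?thesis by blast
  qed
  have "f ` B = (\<Union>k. f ` (B \<inter> K k))" using \<D>(6) KU by blast
  then have "?h (f ` B) \<le> (\<Sum>k. ?h (f ` (B \<inter> K k)))"
    by (simp only: hausdorff_pre_measure_UN_le)
  also have "\<dots> \<le> (\<Sum>k. ennreal C * emeasure lborel (interior (K k)))"
  proof (intro suminf_le allI)
    show "?h (f ` (B \<inter> K k)) \<le> ennreal C * emeasure lborel (interior (K k))" for k
    proof (cases "K k = {}")
      case True
      then show ?thesis
        using hausdorff_pre_measure_image_le_card[of "{}" "\<lambda>x. x" "{}" 0 \<delta> f ?n] pos by simp
    next
      case False then show ?thesis using K cube by blast
    qed
  qed auto
  also have "\<dots> = ennreal C * emeasure lborel (\<Union>k. interior (K k))"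
    unfolding ennreal_suminf_cmult using disj by (subst suminf_emeasure) auto
  also have "\<dots> \<le> ennreal C * (emeasure lborel B + ennreal \<eta>)"
  proof (intro mult_left_mono)
    have "emeasure lborel (\<Union>k. interior (K k)) \<le> emeasure lborel (B \<union> (U - B))"
      using intU U B by (intro emeasure_mono) auto
    also have "\<dots> \<le> emeasure lborel B + emeasure lborel (U - B)"
      using U B by (intro emeasure_subadditive) auto
    also have "\<dots> \<le> emeasure lborel B + ennreal \<eta>"
      using U(3) by (intro add_mono) auto
    finally show "emeasure lborel (\<Union>k. interior (K k)) \<le> emeasure lborel B + ennreal \<eta>" .
  qed auto
  finally show ?thesis by (simp add: C_def)
qed

section \<open>Critical points\<close>

text \<open>A rank below the dimension forces a nonzero vector in the kernel of the seminorm, which is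
  rescaled by its largest coordinate.\<close>

lemma Crit_direction:
  fixes f :: "'a::euclidean_space \<Rightarrow> 'x::metric_space"
  assumes "open \<Omega>" and x: "x \<in> Crit \<Omega> f"
  obtains v where "v \<in> max_coordinate_one"
    and "\<And>\<epsilon>. 0 < \<epsilon> \<Longrightarrow> \<exists>r>0. \<forall>t. norm (t *\<^sub>R v) < r \<longrightarrow> dist (f (x + t *\<^sub>R v)) (f x) \<le> \<epsilon> * \<bar>t\<bar>"
proof -
  obtain \<sigma> where \<sigma>: "has_metric_derivative \<Omega> f x \<sigma>" and "x \<in> \<Omega>"
    using x by (auto simp: Crit_def metrically_differentiable_def)
  then have "md \<Omega> f x = \<sigma>" using md_eqI assms(1) by blast
  with x have "dim {v. \<sigma> v = 0} \<noteq> 0" by (auto simp: Crit_def seminorm_rank_def simp del: dim_eq_0)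
  then obtain w where w: "\<sigma> w = 0" "w \<noteq> 0" by (auto simp: dim_eq_0)
  define N where "N = Max ((\<lambda>j. \<bar>w \<bullet> j\<bar>) ` Basis)"
  have "N \<in> (\<lambda>j. \<bar>w \<bullet> j\<bar>) ` Basis" unfolding N_def by (intro Max_in) auto
  then obtain i where i: "i \<in> Basis" "N = \<bar>w \<bullet> i\<bar>" by blast
  have le: "\<bar>w \<bullet> j\<bar> \<le> \<bar>w \<bullet> i\<bar>" if "j \<in> Basis" for j
    unfolding i(2)[symmetric] N_def using that by (intro Max_ge) auto
  have "w \<bullet> i \<noteq> 0"
  proof
    assume "w \<bullet> i = 0"
    then have "\<forall>j\<in>Basis. w \<bullet> j = 0" using le by simp
    then show False using w by (simp add: euclidean_all_zero_iff)
  qed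
  define v where "v = (1 / (w \<bullet> i)) *\<^sub>R w"
  have v: "v \<in> max_coordinate_one"
    using i \<open>w \<bullet> i \<noteq> 0\<close> le by (auto simp: max_coordinate_one_def v_def field_simps intro!: bexI[of _ i])
  then have "v \<noteq> 0" by (auto simp: max_coordinate_one_def)
  have "\<sigma> (t *\<^sub>R v) = 0" for t
    using \<sigma> w by (simp add: v_def has_metric_derivative_def seminorm_def)
  moreover have lim: "((\<lambda>y. (dist (f y) (f x) - \<sigma> (y - x)) / norm (y - x)) \<longlongrightarrow> 0) (at x)"
    using \<sigma> at_within_open[OF \<open>x \<in> \<Omega>\<close> assms(1)] by (simp add: has_metric_derivative_def)
  ultimately have "\<exists>r>0. \<forall>t. norm (t *\<^sub>R v) < r \<longrightarrow> dist (f (x + t *\<^sub>R v)) (f x) \<le> \<epsilon> * \<bar>t\<bar>"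
    if "0 < \<epsilon>" for \<epsilon>
  proof -
    have "0 < \<epsilon> / norm v" using that \<open>v \<noteq> 0\<close> by simp
    with lim obtain r where r: "0 < r" "\<And>y. y \<noteq> x \<Longrightarrow> dist y x < r \<Longrightarrow>
        \<bar>(dist (f y) (f x) - \<sigma> (y - x)) / norm (y - x)\<bar> < \<epsilon> / norm v"
      by (auto simp: tendsto_iff eventually_at dist_real_def)
    have "dist (f (x + t *\<^sub>R v)) (f x) \<le> \<epsilon> * \<bar>t\<bar>" if "norm (t *\<^sub>R v) < r" for t
    proof (cases "t = 0")
      case False
      have "\<bar>dist (f (x + t *\<^sub>R v)) (f x) / norm (t *\<^sub>R v)\<bar> < \<epsilon> / norm v"
        using r(2)[of "x + t *\<^sub>R v"] that False \<open>v \<noteq> 0\<close> \<open>\<And>t. \<sigma> (t *\<^sub>R v) = 0\<close>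
        by (simp add: dist_norm)
      then show ?thesis using False \<open>v \<noteq> 0\<close> by (simp add: field_simps)
    qed auto
    with r(1) show ?thesis by blast
  qed
  with v that show thesis by blast
qed

text \<open>Replacing the kernel direction \<open>v0\<close> by a nearby \<open>v\<close> moves \<open>x + t v0\<close> by
  \<open>\<bar>t\<bar> * dist v v0\<close>, which by the Lipschitz bound costs only a small multiple of \<open>\<bar>t\<bar>\<close>. Hence a
  countable dense set of directions suffices.\<close>

lemma Crit_subset_nearly_constant_along:
  fixes f :: "'a::euclidean_space \<Rightarrow> 'x::metric_space"
  assumes "open \<Omega>" and lip: "L-lipschitz_on \<Omega> f" and "0 < \<epsilon>"
    and T: "T \<subseteq> max_coordinate_one" "max_coordinate_one \<subseteq> closure T"
  shows "Crit \<Omega> f \<subseteq> (\<Union>v\<in>T. \<Union>k. nearly_constant_along \<Omega> f v (1 / real (Suc k)) \<epsilon>)"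
proof
  fix x assume x: "x \<in> Crit \<Omega> f"
  have L: "0 \<le> L" using lip by (rule lipschitz_on_nonneg)
  \<comment> \<open>The error is \<open>e * \<bar>t\<bar>\<close> from the differentiability at \<open>x\<close> and \<open>L * e * \<bar>t\<bar>\<close> from changing
    the direction.\<close>
  define e where "e = \<epsilon> / (L + 1)"
  have e: "0 < e" using L \<open>0 < \<epsilon>\<close> by (simp add: e_def)
  obtain v0 where v0: "v0 \<in> max_coordinate_one"
    and der: "\<And>\<epsilon>. 0 < \<epsilon> \<Longrightarrow> \<exists>r>0. \<forall>t. norm (t *\<^sub>R v0) < r \<longrightarrow> dist (f (x + t *\<^sub>R v0)) (f x) \<le> \<epsilon> * \<bar>t\<bar>"
    using Crit_direction[OF \<open>open \<Omega>\<close> x] by blast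
  obtain r where r: "0 < r" "\<And>t. norm (t *\<^sub>R v0) < r \<Longrightarrow> dist (f (x + t *\<^sub>R v0)) (f x) \<le> e * \<bar>t\<bar>"
    using der[OF e] by blast
  obtain v where v: "v \<in> T" "dist v v0 < e"
    using T v0 e closure_approachable by blast
  have "x \<in> \<Omega>" using x by (simp add: Crit_def)
  then obtain r' where r': "0 < r'" "ball x r' \<subseteq> \<Omega>"
    using \<open>open \<Omega>\<close> by (meson openE)
  define n where "n = real DIM('a)"
  have n: "1 \<le> n" by (simp add: n_def Suc_leI)
  obtain k where "inverse (real (Suc k)) < min r r' / n"
    using reals_Archimedean[of "min r r' / n"] r r' n by auto
  then have k: "1 / real (Suc k) * n < r" "1 / real (Suc k) * n < r'"
    using n by (simp_all add: field_simps)
  have nv: "norm v0 \<le> n"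
    using norm_max_coordinate_one_le v0 by (auto simp: n_def)
  have one_le: "1 \<le> norm v"
  proof -
    have "v \<in> max_coordinate_one" using v T by blast
    then obtain i where i: "i \<in> Basis" "v \<bullet> i = 1" by (auto simp: max_coordinate_one_def)
    then show ?thesis using Basis_le_norm[of i v] by simp
  qed
  have small: "1 / real (Suc k) < r'"
  proof -
    have "1 / real (Suc k) * 1 \<le> 1 / real (Suc k) * n" using n by (intro mult_left_mono) auto
    with k show ?thesis by linarith
  qed
  have "dist (f (x + t *\<^sub>R v)) (f x) \<le> \<epsilon> * \<bar>t\<bar>" if t: "norm (t *\<^sub>R v) < 1 / real (Suc k)" for t
  proof -
    have "\<bar>t\<bar> * 1 \<le> \<bar>t\<bar> * norm v" using one_le by (intro mult_left_mono) auto
    with t have t1: "\<bar>t\<bar> < 1 / real (Suc k)" by simp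
    have "\<bar>t\<bar> * norm v0 \<le> 1 / real (Suc k) * n" using t1 nv by (intro mult_mono) auto
    with k have tv0: "norm (t *\<^sub>R v0) < r" "norm (t *\<^sub>R v0) < r'" by auto
    have \<Omega>: "x + t *\<^sub>R v \<in> \<Omega>" "x + t *\<^sub>R v0 \<in> \<Omega>"
      using r'(2) t tv0 small by (auto simp: subset_eq dist_norm)
    have "dist (f (x + t *\<^sub>R v)) (f x) \<le>
        dist (f (x + t *\<^sub>R v)) (f (x + t *\<^sub>R v0)) + dist (f (x + t *\<^sub>R v0)) (f x)"
      by (rule dist_triangle)
    also have "\<dots> \<le> L * (\<bar>t\<bar> * e) + e * \<bar>t\<bar>"
    proof (rule add_mono)
      have "dist (f (x + t *\<^sub>R v)) (f (x + t *\<^sub>R v0)) \<le> L * dist (x + t *\<^sub>R v) (x + t *\<^sub>R v0)"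
        using lip \<Omega> by (auto dest: lipschitz_onD)
      also have "dist (x + t *\<^sub>R v) (x + t *\<^sub>R v0) = \<bar>t\<bar> * dist v v0"
        by (simp add: dist_norm flip: scaleR_diff_right)
      also have "L * (\<bar>t\<bar> * dist v v0) \<le> L * (\<bar>t\<bar> * e)"
        using L v by (intro mult_left_mono) auto
      finally show "dist (f (x + t *\<^sub>R v)) (f (x + t *\<^sub>R v0)) \<le> L * (\<bar>t\<bar> * e)" .
    qed (rule r(2)[OF tv0(1)])
    also have "\<dots> = ((L + 1) * e) * \<bar>t\<bar>" by (simp add: algebra_simps)
    also have "(L + 1) * e = \<epsilon>" using L by (simp add: e_def)
    finally show ?thesis .
  qed
  moreover have "ball x (1 / real (Suc k)) \<subseteq> \<Omega>"
    using r'(2) small by (meson ball_subset_ball_iff less_imp_le order_trans subset_ball)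
  ultimately show "x \<in> (\<Union>v\<in>T. \<Union>k. nearly_constant_along \<Omega> f v (1 / real (Suc k)) \<epsilon>)"
    using v(1) by (auto simp: nearly_constant_along_def)
qed

text \<open>Disjointness of the pieces is essential: the number of directions needed grows with \<open>m\<close>, so
  summing over overlapping pieces would destroy the factor \<open>1 / m\<close>. The summand 1 on the right is the
  total of the outer approximation errors \<open>1 / 2 ^ (j + 1)\<close>.\<close>

lemma hausdorff_pre_measure_image_Crit_le:
  fixes f :: "'a::euclidean_space \<Rightarrow> 'x::metric_space" and m :: nat
  assumes "open \<Omega>" and lip: "L-lipschitz_on \<Omega> f" and "0 < \<delta>" and m: "0 < m"
    and Q: "Q \<in> sets borel" "bounded Q"
  shows "hausdorff_pre_measure DIM('a) \<delta> (f ` (Crit \<Omega> f \<inter> Q))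
    \<le> ennreal (unit_ball_vol DIM('a) / 2 ^ DIM('a) * (4 * (1 + L * DIM('a))) ^ DIM('a) / m)
        * (emeasure lborel Q + 1)"
proof -
  let ?n = "DIM('a)" and ?h = "hausdorff_pre_measure DIM('a) \<delta>"
  define C where "C = unit_ball_vol ?n / 2 ^ ?n * (4 * (1 + L * ?n)) ^ ?n / m"
  obtain T :: "'a set" where T: "countable T" "T \<subseteq> max_coordinate_one" "max_coordinate_one \<subseteq> closure T"
    by (rule separable)
  have "One \<in> (max_coordinate_one :: 'a set)"
    using nonempty_Basis by (auto simp: max_coordinate_one_def ex_in_conv)
  then have "T \<noteq> {}" using T by auto
  then have "T \<times> (UNIV :: nat set) \<noteq> {}" by auto
  then obtain d :: "nat \<Rightarrow> 'a \<times> nat" where d: "range d = T \<times> UNIV"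
    using T(1) uncountable_def by (metis countable_SIGMA countableI_type)
  define A where "A j = nearly_constant_along \<Omega> f (fst (d j)) (1 / real (Suc (snd (d j)))) (1 / real m)" for j
  have "continuous_on \<Omega> f" using lip by (rule lipschitz_on_continuous_on)
  then have A: "range A \<subseteq> sets borel"
    unfolding A_def by (auto intro!: borel_closed closed_nearly_constant_along)
  have dT: "fst (d j) \<in> max_coordinate_one" for j
  proof -
    have "d j \<in> T \<times> UNIV" using d by blast
    then show ?thesis using T(2) by auto
  qed
  have CA: "Crit \<Omega> f \<subseteq> (\<Union>j. A j)"
  proof
    fix x assume "x \<in> Crit \<Omega> f"
    with Crit_subset_nearly_constant_along[OF \<open>open \<Omega>\<close> lip _ T(2,3), of "1 / real m"] m
    obtain v k where vk: "v \<in> T" "x \<in> nearly_constant_along \<Omega> f v (1 / real (Suc k)) (1 / real m)"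
      by auto
    then have "(v, k) \<in> range d" using d by auto
    then obtain j where "d j = (v, k)" by (metis imageE)
    with vk show "x \<in> (\<Union>j. A j)" by (auto simp: A_def intro!: exI[of _ j])
  qed
  define B where "B j = disjointed A j \<inter> Q" for j
  have B: "B j \<in> sets borel" for j
    using sets.range_disjointed_sets[OF A] Q by (auto simp: B_def)
  have disj: "disjoint_family B"
    using disjoint_family_disjointed[of A] by (fastforce simp: B_def disjoint_family_on_def)
  have "Crit \<Omega> f \<inter> Q \<subseteq> (\<Union>j. B j)"
    using CA UN_disjointed_eq[of A] by (auto simp: B_def)
  then have "?h (f ` (Crit \<Omega> f \<inter> Q)) \<le> ?h (\<Union>j. f ` B j)"
    by (intro hausdorff_pre_measure_mono) blast
  also have "\<dots> \<le> (\<Sum>j. ?h (f ` B j))" by (rule hausdorff_pre_measure_UN_le)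
  also have "\<dots> \<le> (\<Sum>j. ennreal C * (emeasure lborel (B j) + ennreal ((1/2) ^ Suc j)))"
  proof (intro suminf_le allI)
    fix j
    have "B j \<subseteq> A j" using disjointed_subset[of A j] by (auto simp: B_def)
    then have sub: "B j \<subseteq> nearly_constant_along \<Omega> f (fst (d j)) (1 / real (Suc (snd (d j)))) (1 / real m)"
      by (simp add: A_def)
    have bdd: "bounded (B j)" using Q(2) by (auto simp: B_def)
    have pos: "0 < 1 / real (Suc (snd (d j)))" "0 < (1/2 :: real) ^ Suc j" by simp_all
    show "?h (f ` B j) \<le> ennreal C * (emeasure lborel (B j) + ennreal ((1/2) ^ Suc j))"
      unfolding C_def
      by (rule hausdorff_pre_measure_image_nearly_constant_le
            [OF lip dT m B bdd sub pos(1) \<open>0 < \<delta>\<close> pos(2)])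
  qed auto
  also have "\<dots> = ennreal C * ((\<Sum>j. emeasure lborel (B j)) + (\<Sum>j. ennreal ((1/2) ^ Suc j)))"
    by (simp add: suminf_add[symmetric])
  also have "(\<Sum>j. ennreal ((1/2) ^ Suc j)) = 1"
    by (subst suminf_ennreal_eq[OF zero_le_power power_half_series]) auto
  also have "(\<Sum>j. emeasure lborel (B j)) = emeasure lborel (\<Union>j. B j)"
    using B disj by (intro suminf_emeasure) auto
  also have "ennreal C * (emeasure lborel (\<Union>j. B j) + 1) \<le> ennreal C * (emeasure lborel Q + 1)"
    using Q(1) by (intro mult_left_mono add_mono emeasure_mono) (auto simp: B_def)
  finally show ?thesis by (simp add: C_def)
qed

lemma hausdorff_measure_image_Crit:
  fixes f :: "'a::euclidean_space \<Rightarrow> 'x::metric_space"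
  assumes "open \<Omega>" and lip: "L-lipschitz_on \<Omega> f"
  shows "hausdorff_measure DIM('a) (f ` Crit \<Omega> f) = 0"
proof -
  let ?n = "DIM('a)"
  define C where "C = unit_ball_vol ?n / 2 ^ ?n * (4 * (1 + L * ?n)) ^ ?n"
  have L: "0 \<le> L" using lip by (rule lipschitz_on_nonneg)
  have C: "0 \<le> C" using L by (simp add: C_def)
  have "hausdorff_pre_measure ?n \<delta> (f ` Crit \<Omega> f) = 0" if "0 < \<delta>" for \<delta>
  proof -
    have null: "hausdorff_pre_measure ?n \<delta> (f ` (Crit \<Omega> f \<inter> ball 0 (real k))) = 0" (is "?z = 0") for k
    proof -
      define e where "e = measure lborel (ball (0::'a) (real k)) + 1"
      have "emeasure lborel (ball (0::'a) (real k)) = ennreal (measure lborel (ball (0::'a) (real k)))"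
        by (intro emeasure_eq_ennreal_measure less_imp_neq emeasure_lborel_ball_finite[unfolded infinity_ennreal_def])
      then have e: "emeasure lborel (ball (0::'a) (real k)) + 1 = ennreal e"
        by (simp add: e_def)
      have "?z \<le> ennreal (C / real (Suc m) * e)" for m
      proof -
        have "?z \<le> ennreal (C / real (Suc m)) * ennreal e"
          unfolding e[symmetric] C_def
          by (rule hausdorff_pre_measure_image_Crit_le[OF assms that]) auto
        also have "\<dots> = ennreal (C / real (Suc m) * e)"
          using C by (intro ennreal_mult'[symmetric]) auto
        finally show ?thesis .
      qed
      moreover have "(\<lambda>m. ennreal (C / real (Suc m) * e)) \<longlonglongrightarrow> ennreal (0 * e)"
        by (intro tendsto_ennrealI tendsto_mult tendsto_const
             LIMSEQ_Suc[OF lim_const_over_n])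
      ultimately have "?z \<le> ennreal (0 * e)"
        by (intro LIMSEQ_le_const) auto
      then show ?thesis by simp
    qed
    have "f ` Crit \<Omega> f = (\<Union>k. f ` (Crit \<Omega> f \<inter> ball 0 (real k)))"
      using reals_Archimedean2 by (fastforce simp: dist_norm)
    then have "hausdorff_pre_measure ?n \<delta> (f ` Crit \<Omega> f)
        \<le> (\<Sum>k. hausdorff_pre_measure ?n \<delta> (f ` (Crit \<Omega> f \<inter> ball 0 (real k))))"
      by (simp only: hausdorff_pre_measure_UN_le)
    then show ?thesis by (simp add: null)
  qed
  then show ?thesis by (simp add: hausdorff_measure_def)
qed

theorem theorem1p3:
  fixes \<Omega> :: "(real ^ 'n) set" and f :: "real ^ 'n \<Rightarrow> 'x::metric_space"
  assumes "open \<Omega>"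
    and "\<exists>L. L-lipschitz_on \<Omega> f"
  shows "hausdorff_measure CARD('n) (f ` Crit \<Omega> f) = 0"
  using hausdorff_measure_image_Crit[OF assms(1)] assms(2) by auto

end
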